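(* Let $D$ be a positive integer. For an integer $c \ge 0$, consider the Diophantine equation $x^2 + D = 2^c y$ in integers $x, y$ with $2 \nmid y$. (a) If $D$ is not of the form $2^{2k}(8j+7)$ with $k, j \in \mathbb{Z}_{\geq 0}$, then there exist infinitely many integers $c \ge 0$ such that $x^2 + D = 2^c y$ has no solution in integers $x, y$ with $y$ odd. (b) If $D = 2^{2k}(8j+7)$ for some $k, j \in \mathbb{Z}_{\geq 0}$, then $x^2 + D = 2^c y$ has a solution in integers $x, y$ with $y$ odd for all except finitely many integers $c \ge 0$. Further, if $D = 8j+7$ with $j \in \mathbb{Z}_{\ge 0}$, then the set of integers $c\ge 0$ for which the equation has a solution in integers $x,y$ with $y$ odd contains neither $1$ nor $2$.
   Context: Since $y$ is required to be odd, $c$ is the $2$-adic valuation of $x^2+D$, i.e. the exponent of the largest power of $2$ dividing $x^2+D$; in particular $c \ge 0$. *)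

theory Defs
  imports Main
begin

definition solvable_exponents :: "int \<Rightarrow> nat set" where
  "solvable_exponents D = {c. \<exists>x y :: int. odd y \<and> x ^ 2 + D = 2 ^ c * y}"

definition exceptional_form :: "int \<Rightarrow> bool" where
  "exceptional_form D \<longleftrightarrow> (\<exists>k j :: nat. D = 2 ^ (2 * k) * (8 * int j + 7))"

end

theory Submission
  imports Defs "HOL-Computational_Algebra.Euclidean_Algorithm"
begin

text \<open>
  The problem is about \<open>-D\<close> being a square in the \<open>2\<close>-adic integers.
  Write \<open>D = 2 ^ (2 * k) * m\<close> with \<open>4\<close> not dividing \<open>m\<close>; then \<open>D\<close> is exceptional exactly
  when \<open>m\<close> is \<open>7\<close> modulo \<open>8\<close>, that is, when \<open>-m\<close> is an odd \<open>2\<close>-adic square.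

  If some \<open>x\<^sup>2 + D\<close> is divisible by \<open>2 ^ (2 * k + 3)\<close>, all the factors \<open>4\<close> can be cancelled, and
  the possible residues \<open>0, 1, 4\<close> of a square modulo \<open>8\<close> leave only \<open>m \<equiv> 7\<close>
  (lemma \<open>power_2_dvd_imp_mod_8_eq_7\<close>). So a non-exceptional \<open>D\<close> admits no exponent
  from \<open>2 * k + 3\<close> on.

  Conversely, if \<open>m \<equiv> 7\<close> modulo \<open>8\<close>, every exponent \<open>c \<ge> 3\<close> is attained for \<open>m\<close> by a
  Hensel-type argument (lemma \<open>attains_all_exponents_ge_3\<close>). Replacing an odd \<open>x\<close> by
  \<open>x + 2 ^ (c - 1)\<close> keeps \<open>x\<^sup>2 + m\<close> divisible by \<open>2 ^ c\<close> but flips the parity of the cofactor,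
  so the valuation can be kept at exactly \<open>c\<close> or pushed above it as desired.
  Multiplying \<open>x\<close> by \<open>2 ^ k\<close> then attains every exponent from \<open>2 * k + 3\<close> on for \<open>D\<close>.
\<close>

lemma square_mod_8:
  fixes x :: int
  shows "x ^ 2 mod 8 = (if odd x then 1 else if 4 dvd x then 0 else 4)"
proof -
  have "x mod 8 \<in> {0, 1, 2, 3, 4, 5, 6, 7}"
    by auto
  moreover have "x ^ 2 mod 8 = (x mod 8) ^ 2 mod 8"
    by (simp add: power_mod)
  ultimately show ?thesis
    by (auto; presburger)
qed

text \<open>
  As long as a factor \<open>4\<close> is left in the constant term, \<open>x\<close> must be even and the whole divisibility
  can be divided by \<open>4\<close>; the bound \<open>2 * k + 3\<close> leaves a divisibility by \<open>8\<close> at the end.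
\<close>

lemma power_2_dvd_imp_mod_8_eq_7:
  fixes x m :: int
  assumes "2 ^ (2 * k + 3) dvd x ^ 2 + 4 ^ k * m" and "\<not> 4 dvd m"
  shows "m mod 8 = 7"
  using assms(1)
proof (induction k arbitrary: x)
  case 0
  then have "(x ^ 2 mod 8 + m) mod 8 = 0"
    by (simp add: mod_simps)
  with assms(2) show ?case
    unfolding square_mod_8 by (auto split: if_splits; presburger)
next
  case (Suc k)
  have "even (x ^ 2 + 4 ^ Suc k * m)"
    using Suc.prems by (rule dvd_trans[rotated]) simp
  then have "even x"
    by simp
  then obtain z where z: "x = 2 * z" ..
  have "4 * 2 ^ (2 * k + 3) dvd 4 * (z ^ 2 + 4 ^ k * m)"
    using Suc.prems by (simp add: z power_mult_distrib power_add distrib_left mult.assoc)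
  then have "2 ^ (2 * k + 3) dvd z ^ 2 + 4 ^ k * m"
    by (subst (asm) dvd_mult_cancel_left) simp
  then show ?case
    by (rule Suc.IH)
qed

text \<open>
  The cross term \<open>2 ^ c * x\<close> of the shifted square changes the cofactor by the odd number \<open>x\<close>, while
  the square \<open>2 ^ (2 * c - 2)\<close> changes it by \<open>2 ^ (c - 2)\<close>, which is even precisely because
  \<open>c \<ge> 3\<close>.
\<close>

lemma shift_flips_cofactor_parity:
  fixes x m t :: int
  assumes "odd x" and "c \<ge> 3" and "x ^ 2 + m = 2 ^ c * t"
  obtains x' t' where "odd x'" and "x' ^ 2 + m = 2 ^ c * t'" and "even t' \<longleftrightarrow> odd t"
proof
  obtain d where c: "c = d + 3"
    using \<open>c \<ge> 3\<close> by (metis add.commute le_Suc_ex)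
  show "odd (x + 2 ^ (c - 1))"
    using assms(1) by (simp add: c)
  show "(x + 2 ^ (c - 1)) ^ 2 + m = 2 ^ c * (t + x + 2 ^ (c - 2))"
    using assms(3) by (simp add: c power2_eq_square power_add algebra_simps)
  show "even (t + x + 2 ^ (c - 2)) \<longleftrightarrow> odd t"
    using assms(1) by (simp add: c)
qed

text \<open>
  The induction needs at most two shifts per step: one at level \<open>c\<close> to gain divisibility by
  \<open>2 ^ (c + 1)\<close>, and one at level \<open>c + 1\<close> if the gain was too large.
\<close>

lemma attains_all_exponents_ge_3:
  fixes m :: int
  assumes "m mod 8 = 7" and "c \<ge> 3"
  shows "\<exists>x y. odd x \<and> odd y \<and> x ^ 2 + m = 2 ^ c * y"
proof -
  have exact: "\<exists>x y. odd x \<and> odd y \<and> x ^ 2 + m = 2 ^ c * y"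
    if "odd x" "c \<ge> 3" "x ^ 2 + m = 2 ^ c * t" for c and x t :: int
    using that by (metis shift_flips_cofactor_parity)
  show ?thesis
    using \<open>c \<ge> 3\<close>
  proof (induction c rule: dec_induct)
    case base
    have "1 ^ 2 + m = 2 ^ 3 * (m div 8 + 1)"
      using assms(1) by simp presburger
    then show ?case
      by (rule exact[rotated 2]) simp_all
  next
    case (step c)
    then obtain x y where "odd x" "odd y" "x ^ 2 + m = 2 ^ c * y"
      by blast
    with \<open>3 \<le> c\<close> obtain x' t where x': "odd x'" "x' ^ 2 + m = 2 ^ c * t" "even t"
      by (metis shift_flips_cofactor_parity)
    from \<open>even t\<close> obtain s where "t = 2 * s" ..
    with x' have "x' ^ 2 + m = 2 ^ Suc c * s"
      by simp
    with \<open>odd x'\<close> \<open>3 \<le> c\<close> show ?case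
      using exact[of x' "Suc c" s] by simp
  qed
qed

lemma exceptional_form_iff:
  assumes "D > 0"
  shows "exceptional_form D \<longleftrightarrow> (\<exists>k m. D = 4 ^ k * m \<and> m mod 8 = 7)"
proof
  assume "exceptional_form D"
  then obtain k j where "D = 2 ^ (2 * k) * (8 * int j + 7)"
    unfolding exceptional_form_def by blast
  then have "D = 4 ^ k * (8 * int j + 7) \<and> (8 * int j + 7) mod 8 = 7"
    by (simp add: power_mult)
  then show "\<exists>k m. D = 4 ^ k * m \<and> m mod 8 = 7"
    by blast
next
  assume "\<exists>k m. D = 4 ^ k * m \<and> m mod 8 = 7"
  then obtain k m where D: "D = 4 ^ k * m" and m: "m mod 8 = 7"
    by blast
  have "m > 0"
    using assms by (simp add: D zero_less_mult_iff)
  with m have "m = 8 * int (nat (m div 8)) + 7"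
    by simp presburger
  then have "D = 2 ^ (2 * k) * (8 * int (nat (m div 8)) + 7)"
    using D by (simp add: power_mult)
  then show "exceptional_form D"
    unfolding exceptional_form_def by blast
qed

lemma large_exponents_unsolvable:
  assumes "D > 0" and "\<not> exceptional_form D"
  obtains N where "{N..} \<subseteq> {c. c \<notin> solvable_exponents D}"
proof -
  have "\<not> is_unit (4 :: int)"
    by simp
  then obtain m where D: "D = 4 ^ multiplicity 4 D * m" and m: "\<not> 4 dvd m"
    using multiplicity_decompose'[of D 4] \<open>D > 0\<close> by (metis less_irrefl)
  define k where "k = multiplicity 4 D"
  have "m mod 8 \<noteq> 7"
    using assms D exceptional_form_iff by blast
  have "c \<notin> solvable_exponents D" if "c \<ge> 2 * k + 3" for c
  proof
    assume "c \<in> solvable_exponents D"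
    then obtain x y where "x ^ 2 + D = 2 ^ c * y"
      unfolding solvable_exponents_def by blast
    then have "x ^ 2 + 4 ^ k * m = 2 ^ c * y"
      using D by (simp add: k_def)
    then have "2 ^ (2 * k + 3) dvd x ^ 2 + 4 ^ k * m"
      using that by (simp add: le_imp_power_dvd dvd_mult2)
    with m \<open>m mod 8 \<noteq> 7\<close> show False
      using power_2_dvd_imp_mod_8_eq_7 by blast
  qed
  then have "{2 * k + 3..} \<subseteq> {c. c \<notin> solvable_exponents D}"
    by auto
  then show thesis
    by (rule that)
qed

lemma large_exponents_solvable:
  assumes "m mod 8 = 7" and "c \<ge> 2 * k + 3"
  shows "c \<in> solvable_exponents (4 ^ k * m)"
proof -
  obtain b where b: "c = 2 * k + b" and "b \<ge> 3"
    using assms(2) by (metis le_Suc_ex add.assoc le_add1)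
  then obtain x y where "odd y" and xy: "x ^ 2 + m = 2 ^ b * y"
    using attains_all_exponents_ge_3[OF assms(1)] by blast
  have power_4_eq: "(2 ^ k) ^ 2 = (4 :: int) ^ k"
    by (simp add: power2_eq_square flip: power_mult_distrib)
  have "(2 ^ k * x) ^ 2 + 4 ^ k * m = 4 ^ k * (x ^ 2 + m)"
    by (simp add: power_mult_distrib distrib_left power_4_eq)
  also have "\<dots> = 2 ^ c * y"
    by (simp add: xy b power_add power_mult)
  finally show ?thesis
    unfolding solvable_exponents_def using \<open>odd y\<close> by blast
qed

text \<open>
  For \<open>D \<equiv> 7\<close> modulo \<open>8\<close> the valuation jumps: \<open>x\<^sup>2 + D\<close> is odd for even \<open>x\<close> and
  divisible by \<open>8\<close> for odd \<open>x\<close>.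
\<close>

lemma solvable_exponents_gap:
  assumes "D mod 8 = 7" and "c \<in> solvable_exponents D"
  shows "c = 0 \<or> c \<ge> 3"
proof (rule ccontr)
  assume "\<not> (c = 0 \<or> c \<ge> 3)"
  then have c: "c = 1 \<or> c = 2"
    by auto
  obtain x y where "odd y" and xy: "x ^ 2 + D = 2 ^ c * y"
    using assms(2) unfolding solvable_exponents_def by blast
  have "even (x ^ 2 + D)"
    using c xy by auto
  moreover have "odd D"
    using assms(1) by presburger
  ultimately have "odd x"
    by simp
  then have "x ^ 2 mod 8 = 1"
    by (simp add: square_mod_8)
  with assms(1) have "(x ^ 2 + D) mod 8 = 0"
    by presburger
  with c \<open>odd y\<close> show False
    unfolding xy by (auto; presburger)
qed

theorem theorem1p1:
  fixes D :: int
  assumes "D > 0"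
  shows "(\<not> exceptional_form D \<longrightarrow> infinite {c. c \<notin> solvable_exponents D}) \<and>
    (exceptional_form D \<longrightarrow> finite {c. c \<notin> solvable_exponents D}) \<and>
    ((\<exists>j :: nat. D = 8 * int j + 7) \<longrightarrow>
      1 \<notin> solvable_exponents D \<and> 2 \<notin> solvable_exponents D)"
proof (intro conjI impI)
  assume "\<not> exceptional_form D"
  with assms obtain N where "{N..} \<subseteq> {c. c \<notin> solvable_exponents D}"
    by (rule large_exponents_unsolvable)
  then show "infinite {c. c \<notin> solvable_exponents D}"
    using infinite_Ici infinite_super by blast
next
  assume "exceptional_form D"
  then obtain k m where "D = 4 ^ k * m" and "m mod 8 = 7"
    using exceptional_form_iff[OF assms] by blast
  then have "{c. c \<notin> solvable_exponents D} \<subseteq> {..<2 * k + 3}"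
    using large_exponents_solvable by (auto simp: not_le[symmetric])
  then show "finite {c. c \<notin> solvable_exponents D}"
    by (rule finite_subset) simp
next
  assume "\<exists>j :: nat. D = 8 * int j + 7"
  then have "D mod 8 = 7"
    by presburger
  then show "1 \<notin> solvable_exponents D" and "2 \<notin> solvable_exponents D"
    using solvable_exponents_gap by fastforce+
qed

end
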